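(* Let $A\in\mathbb{R}^{m\times n}$ be an arbitrary matrix of rank $2$, with columns $\hat a_1,\dots,\hat a_n$. For $j_1,j_2\in\{1,\dots,n\}$ with $j_1<j_2$, let $\hat{A}:=[\hat{a}_{j_1},\hat{a}_{j_2}]$ be the $m\times 2$ submatrix of $A$ formed by columns $j_1$ and $j_2$. Suppose that $j_1,j_2$ are chosen so that $\hat A$ has rank $2$ and the 1-norm of $\hat{H}:=\hat{A}^+\in\mathbb{R}^{2\times m}$ is minimum among all $m\times 2$ rank-$2$ submatrices of $A$ formed by two columns. Let $H\in\mathbb{R}^{n\times m}$ be the matrix with all rows equal to zero, except rows $j_1$ and $j_2$, which are given by the first and second rows of $\hat{H}$, respectively. Suppose that $H$ is an ah-symmetric generalized inverse of $A$ with minimum 1-norm, i.e., $\|H\|_1\le\|G\|_1$ for every ah-symmetric generalized inverse $G$ of $A$. Every column $\hat{b}$ of $A$ can be uniquely written in the basis $\hat{a}_{j_1},\hat{a}_{j_2}$, say $\hat{b}=\alpha\hat{a}_{j_1}+\beta\hat{a}_{j_2}$ with $\alpha,\beta\in\mathbb{R}$. Then for each column $\hat{b}$ of $A$, at least one of the following conditions holds for the associated $\alpha,\beta$: (i) $|\alpha|+|\beta|\le 1$; (ii) $\hat{H}_{1j}\hat{H}_{2j}\le 0$ for all $j=1,\dots,m$, and $\alpha\beta\ge 0$; (iii) $\hat{H}_{1j}\hat{H}_{2j}\ge 0$ for all $j=1,\dots,m$, and $\alpha\beta\le 0$.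
   Context: All matrices are real. A generalized inverse of $A\in\mathbb{R}^{m\times n}$ is a matrix $H\in\mathbb{R}^{n\times m}$ with $AHA=A$. It is called ah-symmetric if in addition $AH$ is symmetric, i.e., $(AH)^\top=AH$. For a matrix $H$, $\|H\|_1:=\sum_{i,j}|h_{ij}|$ denotes the vector 1-norm of the entries of $H$ (not the induced operator norm). $A^+$ denotes the Moore-Penrose pseudoinverse of $A$; for a matrix $\hat A$ of full column rank, $\hat A^+=(\hat A^\top\hat A)^{-1}\hat A^\top$. *)

theory Defs
  imports "HOL-Analysis.Analysis"
begin

text \<open>Entrywise 1-norm of a matrix (not an operator norm).\<close>

definition norm1 :: "real^'n^'m \<Rightarrow> real" where
  "norm1 H = (\<Sum>i\<in>UNIV. \<Sum>j\<in>UNIV. \<bar>H $ i $ j\<bar>)"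

definition gen_inverse :: "real^'n^'m \<Rightarrow> real^'m^'n \<Rightarrow> bool" where
  "gen_inverse A H \<longleftrightarrow> A ** H ** A = A"

definition ah_sym_gen_inverse :: "real^'n^'m \<Rightarrow> real^'m^'n \<Rightarrow> bool" where
  "ah_sym_gen_inverse A H \<longleftrightarrow> gen_inverse A H \<and> transpose (A ** H) = A ** H"

definition min_ah_sym_gen_inverse :: "real^'n^'m \<Rightarrow> real^'m^'n \<Rightarrow> bool" where
  "min_ah_sym_gen_inverse A H \<longleftrightarrow>
     ah_sym_gen_inverse A H \<and> (\<forall>G. ah_sym_gen_inverse A G \<longrightarrow> norm1 H \<le> norm1 G)"

text \<open>The Moore-Penrose pseudoinverse, given by the four Penrose conditions.\<close>

definition is_pinv :: "real^'n^'m \<Rightarrow> real^'m^'n \<Rightarrow> bool" where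
  "is_pinv A X \<longleftrightarrow> A ** X ** A = A \<and> X ** A ** X = X \<and>
     transpose (A ** X) = A ** X \<and> transpose (X ** A) = X ** A"

definition pinv :: "real^'n^'m \<Rightarrow> real^'m^'n" where
  "pinv A = (THE X. is_pinv A X)"

lemma is_pinv_unique:
  fixes A :: "real^'n^'m"
  assumes X: "is_pinv A X" and Y: "is_pinv A Y"
  shows "X = Y"
proof -
  have "A ** X = (A ** Y ** A) ** X"
    using Y by (simp add: is_pinv_def)
  also have "\<dots> = transpose (A ** Y) ** transpose (A ** X)"
    using X Y by (simp add: is_pinv_def matrix_mul_assoc)
  also have "\<dots> = transpose ((A ** X ** A) ** Y)"
    by (simp add: matrix_transpose_mul matrix_mul_assoc)
  also have "\<dots> = A ** Y"
    using X Y by (simp add: is_pinv_def)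
  finally have 1: "A ** X = A ** Y" .
  have "X ** A = X ** (A ** Y ** A)"
    using Y unfolding is_pinv_def by metis
  also have "\<dots> = transpose (X ** A) ** transpose (Y ** A)"
    using X Y unfolding is_pinv_def by (metis matrix_mul_assoc)
  also have "\<dots> = transpose (Y ** (A ** X ** A))"
    by (metis matrix_transpose_mul matrix_mul_assoc)
  also have "\<dots> = Y ** A"
    using X Y by (simp add: is_pinv_def)
  finally have 2: "X ** A = Y ** A" .
  have "X = X ** A ** X"
    using X by (simp add: is_pinv_def)
  also have "\<dots> = Y ** A ** Y"
    using 1 2 by (metis matrix_mul_assoc)
  also have "\<dots> = Y"
    using Y by (simp add: is_pinv_def)
  finally show ?thesis .
qed

lemma pinv_full_column_rank:
  fixes A :: "real^'n^'m"
  assumes "rank A = CARD('n)"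
  shows "is_pinv A (pinv A)"
    and "pinv A = matrix_inv (transpose A ** A) ** transpose A"
proof -
  let ?G = "transpose A ** A"
  let ?X = "matrix_inv ?G ** transpose A"
  have inj: "inj ((*v) A)"
    using assms by (simp add: full_rank_injective)
  have "x = 0" if "?G *v x = 0" for x
  proof -
    have "(A *v x) \<bullet> (A *v x) = x \<bullet> (?G *v x)"
      by (metis dot_lmul_matrix inner_commute matrix_vector_mul_assoc vector_transpose_matrix transpose_transpose)
    then have "A *v x = A *v 0"
      using that by simp
    then show ?thesis
      using inj by (meson injD)
  qed
  then have inv: "invertible ?G"
    using invertible_left_inverse matrix_left_invertible_ker by blast
  have "?G ** matrix_inv ?G = mat 1 \<and> matrix_inv ?G ** ?G = mat 1"
    using inv unfolding invertible_def matrix_inv_def by (rule someI_ex)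
  then have l: "matrix_inv ?G ** ?G = mat 1" and r: "?G ** matrix_inv ?G = mat 1"
    by auto
  have XA: "?X ** A = mat 1"
    using l by (simp add: matrix_mul_assoc)
  have "transpose ?G = ?G"
    by (simp add: matrix_transpose_mul)
  then have "transpose (matrix_inv ?G) = matrix_inv ?G"
    by (metis l r matrix_mul_assoc matrix_mul_lid matrix_mul_rid
        matrix_transpose_mul transpose_mat)
  then have "transpose (A ** ?X) = A ** ?X"
    by (simp add: matrix_transpose_mul matrix_mul_assoc)
  moreover have "A ** ?X ** A = A"
    by (metis XA matrix_mul_assoc matrix_mul_rid)
  ultimately have X: "is_pinv A ?X"
    unfolding is_pinv_def using XA by (simp add: transpose_mat)
  then show "pinv A = ?X"
    unfolding pinv_def using is_pinv_unique by blast
  then show "is_pinv A (pinv A)"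
    using X by simp
qed

definition two_cols :: "real^'n^'m \<Rightarrow> 'n \<Rightarrow> 'n \<Rightarrow> real^2^'m" where
  "two_cols A j1 j2 = (\<chi> i k. if k = 1 then A $ i $ j1 else A $ i $ j2)"

definition place_rows :: "'n \<Rightarrow> 'n \<Rightarrow> real^'m^2 \<Rightarrow> real^'m^'n" where
  "place_rows j1 j2 K = (\<chi> i. if i = j1 then K $ 1 else if i = j2 then K $ 2 else 0)"

end

theory Submission
  imports Defs
begin

text \<open>If \<open>A v = 0\<close>, adding a multiple of \<open>v\<close> to a single column of an ah-symmetric generalized
  inverse \<open>H\<close> does not change \<open>A H\<close>, so it yields another one. Minimality of \<open>H\<close> therefore means that
  every column of \<open>H\<close> is 1-norm minimal along every kernel direction. For a column
  \<open>b = \<alpha> a\<^sub>1 + \<beta> a\<^sub>2\<close> of \<open>A\<close>, the kernel direction with entries \<open>1\<close> at \<open>b\<close> and \<open>-\<alpha>\<close>, \<open>-\<beta>\<close> at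
  \<open>a\<^sub>1\<close>, \<open>a\<^sub>2\<close> changes the norm at the rate \<open>1 - \<bar>\<alpha>\<bar> - \<bar>\<beta>\<bar>\<close> when the signs of \<open>(\<alpha>, \<beta>)\<close> agree, up
  to a common sign, with those of a column of \<open>Hhat\<close>. If \<open>\<bar>\<alpha>\<bar> + \<bar>\<beta>\<bar> > 1\<close>, the signs can therefore never
  agree in this way.\<close>

lemma ah_sym_gen_inverse_cong:
  assumes "ah_sym_gen_inverse A H" "A ** G = A ** H"
  shows "ah_sym_gen_inverse A G"
  using assms by (simp add: ah_sym_gen_inverse_def gen_inverse_def)

lemma min_ah_sym_column_le:
  fixes A :: "real^'n^'m"
  assumes min: "min_ah_sym_gen_inverse A H" and v: "A *v v = 0"
  shows "(\<Sum>i\<in>UNIV. \<bar>H $ i $ j\<bar>) \<le> (\<Sum>i\<in>UNIV. \<bar>H $ i $ j + t * v $ i\<bar>)"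
proof -
  define G :: "real^'m^'n" where
    "G = (\<chi> i l. H $ i $ l + (if l = j then t * v $ i else 0))"
  have "(\<Sum>k\<in>UNIV. A $ i $ k * (if l = j then t * v $ k else 0)) = 0" for i l
  proof -
    have "(\<Sum>k\<in>UNIV. A $ i $ k * (t * v $ k)) = t * (A *v v) $ i"
      by (simp add: matrix_vector_mult_def sum_distrib_left mult_ac)
    then show ?thesis
      using v by (cases "l = j") simp_all
  qed
  then have "A ** G = A ** H"
    by (simp add: vec_eq_iff matrix_matrix_mult_def G_def distrib_left sum.distrib)
  then have le: "norm1 H \<le> norm1 G"
    using min ah_sym_gen_inverse_cong by (auto simp: min_ah_sym_gen_inverse_def)
  \<comment> \<open>\<open>G\<close> and \<open>H\<close> agree off column \<open>j\<close>, so
    isolating that column lets the remaining entries cancel in \<open>le\<close>.\<close>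
  have split: "norm1 K = (\<Sum>i\<in>UNIV. \<bar>K $ i $ j\<bar>) + (\<Sum>i\<in>UNIV. \<Sum>l\<in>UNIV - {j}. \<bar>K $ i $ l\<bar>)"
    for K :: "real^'m^'n"
    unfolding norm1_def sum.distrib[symmetric]
    by (intro sum.cong refl sum.remove) auto
  have "(\<Sum>i\<in>UNIV. \<Sum>l\<in>UNIV - {j}. \<bar>G $ i $ l\<bar>) = (\<Sum>i\<in>UNIV. \<Sum>l\<in>UNIV - {j}. \<bar>H $ i $ l\<bar>)"
    by (intro sum.cong refl) (simp add: G_def)
  then show ?thesis
    using le split[of H] split[of G] by (simp add: G_def)
qed

text \<open>The sign \<open>c\<close> turns \<open>a\<close> towards \<open>h\<close>, and the bound
  on \<open>s\<close> keeps the shift from crossing zero, so the absolute value falls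
  linearly.\<close>

lemma abs_diff_scaled:
  fixes h a s c :: real
  assumes "0 \<le> c * a * h" "\<bar>c\<bar> = 1" "0 \<le> s" "s * \<bar>a\<bar> \<le> \<bar>h\<bar>" "h \<noteq> 0"
  shows "\<bar>h - s * c * a\<bar> = \<bar>h\<bar> - s * \<bar>a\<bar>"
proof -
  have "c * a = sgn h * \<bar>a\<bar>"
    using assms(1,2,5) by (cases "h > 0") (auto simp: abs_if zero_le_mult_iff split: if_splits)
  then show ?thesis
    using assms(4,5) by (cases "h > 0") (auto simp: mult.assoc)
qed

text \<open>Otherwise a short move along \<open>c * (\<alpha>, \<beta>)\<close>, for a suitable sign
  \<open>c\<close>, shrinks both entries. The gain per unit, \<bar>\<alpha>\<bar> +
  \<bar>\<beta>\<bar>, then exceeds the unit cost of the term \<bar>t\<bar>.\<close>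

lemma opposite_signs_of_minimal:
  fixes h1 h2 \<alpha> \<beta> :: real
  assumes min: "\<And>t. \<bar>h1\<bar> + \<bar>h2\<bar> \<le> \<bar>h1 - t * \<alpha>\<bar> + \<bar>h2 - t * \<beta>\<bar> + \<bar>t\<bar>"
    and h: "h1 \<noteq> 0" "h2 \<noteq> 0" and gt: "\<bar>\<alpha>\<bar> + \<bar>\<beta>\<bar> > 1"
  shows "(h1 * h2) * (\<alpha> * \<beta>) < 0"
proof (rule ccontr)
  assume "\<not> ?thesis"
  then have nonneg: "0 \<le> (\<alpha> * h1) * (\<beta> * h2)"
    by (simp add: mult_ac)
  \<comment> \<open>By \<open>nonneg\<close>, \<open>\<alpha> * h1\<close> and
    \<open>\<beta> * h2\<close> are both nonnegative or both nonpositive; \<open>c\<close> is that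
    common sign.\<close>
  obtain c :: real where c: "\<bar>c\<bar> = 1" "0 \<le> c * \<alpha> * h1" "0 \<le> c * \<beta> * h2"
  proof (cases "0 \<le> \<alpha> * h1 \<and> 0 \<le> \<beta> * h2")
    case True
    then show ?thesis
      using that[of 1] by simp
  next
    case False
    then show ?thesis
      using that[of "-1"] nonneg by (auto simp: zero_le_mult_iff[of "\<alpha> * h1" "\<beta> * h2"])
  qed
  \<comment> \<open>A step that carries neither entry past zero; the \<open>+ 1\<close> keeps the
    denominators positive even if \<alpha> or \<beta> is zero.\<close>
  define s where "s = min (\<bar>h1\<bar> / (\<bar>\<alpha>\<bar> + 1)) (\<bar>h2\<bar> / (\<bar>\<beta>\<bar> + 1))"
  have s: "s > 0"
    using h by (simp add: s_def)
  have "s * (\<bar>\<alpha>\<bar> + 1) \<le> \<bar>h1\<bar>" "s * (\<bar>\<beta>\<bar> + 1) \<le> \<bar>h2\<bar>"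
    by (simp_all add: s_def flip: pos_le_divide_eq)
  then have "s * \<bar>\<alpha>\<bar> \<le> \<bar>h1\<bar>" "s * \<bar>\<beta>\<bar> \<le> \<bar>h2\<bar>"
    using s by (simp_all add: distrib_left)
  then have "\<bar>h1 - s * c * \<alpha>\<bar> = \<bar>h1\<bar> - s * \<bar>\<alpha>\<bar>" "\<bar>h2 - s * c * \<beta>\<bar> = \<bar>h2\<bar> - s * \<bar>\<beta>\<bar>"
    using c s h by (simp_all add: abs_diff_scaled)
  moreover have "\<bar>s * c\<bar> = s"
    using c s by (simp add: abs_mult)
  ultimately have "s * (\<bar>\<alpha>\<bar> + \<bar>\<beta>\<bar>) \<le> s * 1"
    using min[of "s * c"] by (simp add: distrib_left)
  then show False
    using s gt by simp
qed

lemma two_cols_mult_vec: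
  "two_cols A j1 j2 *v x = x $ 1 *\<^sub>R column j1 A + x $ 2 *\<^sub>R column j2 A"
  by (simp add: vec_eq_iff matrix_vector_mult_def two_cols_def column_def sum_2 mult.commute)

lemma mult_place_rows:
  fixes A :: "real^'n^'m"
  assumes "j1 \<noteq> j2"
  shows "A ** place_rows j1 j2 K = two_cols A j1 j2 ** K"
proof -
  have "(\<Sum>k\<in>UNIV. A $ i $ k * place_rows j1 j2 K $ k $ l) =
      (\<Sum>k\<in>{j1, j2}. A $ i $ k * place_rows j1 j2 K $ k $ l)" for i l
    by (rule sum.mono_neutral_right) (auto simp: place_rows_def)
  then show ?thesis
    using assms by (simp add: vec_eq_iff matrix_matrix_mult_def place_rows_def two_cols_def sum_2)
qed

lemma column_expansion_unique:
  fixes A :: "real^'n^'m"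
  assumes "rank (two_cols A j1 j2) = 2"
    and "a *\<^sub>R column j1 A + b *\<^sub>R column j2 A = c *\<^sub>R column j1 A + d *\<^sub>R column j2 A"
  shows "a = c \<and> b = d"
proof -
  have "inj ((*v) (two_cols A j1 j2))"
    using assms(1) by (simp flip: full_rank_injective)
  moreover have "two_cols A j1 j2 *v vector [a, b] = two_cols A j1 j2 *v vector [c, d]"
    using assms(2) by (simp add: two_cols_mult_vec)
  ultimately have "(vector [a, b] :: real^2) = vector [c, d]"
    by (rule injD)
  then show ?thesis
    by (metis vector_2)
qed

text \<open>The identity \<open>A ** H ** A = A\<close> factors \<open>A\<close> through its two
  chosen columns, so these span all the others.\<close>

lemma column_expansion_exists:
  fixes A :: "real^'n^'m"
  assumes "gen_inverse A (place_rows j1 j2 K)" "j1 \<noteq> j2"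
  shows "\<exists>a b. column k A = a *\<^sub>R column j1 A + b *\<^sub>R column j2 A"
proof -
  have "A = two_cols A j1 j2 ** (K ** A)"
    using assms by (simp add: gen_inverse_def mult_place_rows matrix_mul_assoc)
  then have "column k A = two_cols A j1 j2 *v column k (K ** A)"
    by (metis matrix_mul_assoc matrix_vector_mul_assoc matrix_vector_mult_basis)
  then show ?thesis
    unfolding two_cols_mult_vec by blast
qed

lemma place_rows_column_minimal:
  fixes A :: "real^'n^'m"
  assumes min: "min_ah_sym_gen_inverse A (place_rows j1 j2 K)"
    and j: "j1 \<noteq> j2" and k: "k \<noteq> j1" "k \<noteq> j2"
    and col: "column k A = \<alpha> *\<^sub>R column j1 A + \<beta> *\<^sub>R column j2 A"
  shows "\<bar>K $ 1 $ j\<bar> + \<bar>K $ 2 $ j\<bar> \<le> \<bar>K $ 1 $ j - t * \<alpha>\<bar> + \<bar>K $ 2 $ j - t * \<beta>\<bar> + \<bar>t\<bar>"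
proof -
  \<comment> \<open>Row \<open>k\<close> of \<open>?H\<close> is zero, so the entry \<open>1\<close>
    of \<open>v\<close> at \<open>k\<close> contributes exactly the term \<bar>t\<bar>.\<close>
  define v where "v = axis k 1 - \<alpha> *\<^sub>R axis j1 1 - \<beta> *\<^sub>R axis j2 (1::real)"
  let ?H = "place_rows j1 j2 K"
  have "A *v v = 0"
    by (simp add: v_def matrix_vector_mult_diff_distrib matrix_vector_mult_scaleR
        matrix_vector_mult_basis col)
  then have "(\<Sum>i\<in>UNIV. \<bar>?H $ i $ j\<bar>) \<le> (\<Sum>i\<in>UNIV. \<bar>?H $ i $ j + t * v $ i\<bar>)"
    using min min_ah_sym_column_le by blast
  also have "(\<Sum>i\<in>UNIV. \<bar>?H $ i $ j\<bar>) = (\<Sum>i\<in>{j1, j2, k}. \<bar>?H $ i $ j\<bar>)"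
    by (rule sum.mono_neutral_right) (auto simp: place_rows_def)
  also have "(\<Sum>i\<in>UNIV. \<bar>?H $ i $ j + t * v $ i\<bar>) = (\<Sum>i\<in>{j1, j2, k}. \<bar>?H $ i $ j + t * v $ i\<bar>)"
    by (rule sum.mono_neutral_right) (auto simp: place_rows_def v_def axis_def)
  finally show ?thesis
    using j k by (simp add: place_rows_def v_def axis_def)
qed

theorem theorem9:
  fixes A :: "real^('n::{finite,linorder})^'m"
    and j1 j2 :: 'n
    and Ahat :: "real^2^'m" and Hhat :: "real^'m^2" and H :: "real^'m^('n::{finite,linorder})"
  assumes "rank A = 2"
    and "j1 < j2"
    and "Ahat = two_cols A j1 j2"
    and "rank Ahat = 2"
    and "Hhat = pinv Ahat"
    and "\<And>k1 k2. k1 < k2 \<Longrightarrow> rank (two_cols A k1 k2) = 2 \<Longrightarrow>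
           norm1 Hhat \<le> norm1 (pinv (two_cols A k1 k2))"
    and "H = place_rows j1 j2 Hhat"
    and "min_ah_sym_gen_inverse A H"
  shows "\<forall>k. (\<exists>!p. column k A = fst p *\<^sub>R column j1 A + snd p *\<^sub>R column j2 A) \<and>
    (\<forall>\<alpha> \<beta>. column k A = \<alpha> *\<^sub>R column j1 A + \<beta> *\<^sub>R column j2 A \<longrightarrow>
       \<bar>\<alpha>\<bar> + \<bar>\<beta>\<bar> \<le> 1 \<or>
       (\<forall>j. Hhat $ 1 $ j * Hhat $ 2 $ j \<le> 0) \<and> \<alpha> * \<beta> \<ge> 0 \<or>
       (\<forall>j. Hhat $ 1 $ j * Hhat $ 2 $ j \<ge> 0) \<and> \<alpha> * \<beta> \<le> 0)"
proof (intro allI conjI impI)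
  have j: "j1 \<noteq> j2"
    using assms(2) by auto
  have rank: "rank (two_cols A j1 j2) = 2"
    using assms(3,4) by simp
  have min: "min_ah_sym_gen_inverse A (place_rows j1 j2 Hhat)"
    using assms(7,8) by simp
  fix k
  show "\<exists>!p. column k A = fst p *\<^sub>R column j1 A + snd p *\<^sub>R column j2 A"
  proof -
    obtain a b where ab: "column k A = a *\<^sub>R column j1 A + b *\<^sub>R column j2 A"
      using column_expansion_exists min j
      by (metis min_ah_sym_gen_inverse_def ah_sym_gen_inverse_def)
    show ?thesis
    proof (rule ex1I)
      show "column k A = fst (a, b) *\<^sub>R column j1 A + snd (a, b) *\<^sub>R column j2 A"
        using ab by simp
      show "p = (a, b)" if "column k A = fst p *\<^sub>R column j1 A + snd p *\<^sub>R column j2 A" for p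
        using column_expansion_unique[OF rank, of "fst p" "snd p" a b] that ab
        by (simp add: prod_eq_iff)
    qed
  qed
  fix \<alpha> \<beta>
  assume col: "column k A = \<alpha> *\<^sub>R column j1 A + \<beta> *\<^sub>R column j2 A"
  show "\<bar>\<alpha>\<bar> + \<bar>\<beta>\<bar> \<le> 1 \<or>
       (\<forall>j. Hhat $ 1 $ j * Hhat $ 2 $ j \<le> 0) \<and> \<alpha> * \<beta> \<ge> 0 \<or>
       (\<forall>j. Hhat $ 1 $ j * Hhat $ 2 $ j \<ge> 0) \<and> \<alpha> * \<beta> \<le> 0"
  proof (cases "\<bar>\<alpha>\<bar> + \<bar>\<beta>\<bar> \<le> 1")
    case False
    \<comment> \<open>The columns \<open>j1\<close> and \<open>j2\<close> themselves have
      coefficients \<open>(1, 0)\<close> and \<open>(0, 1)\<close>, whose absolute values sum to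
      1.\<close>
    have "k \<noteq> j1"
      using column_expansion_unique[OF rank, of \<alpha> \<beta> 1 0] col False by auto
    moreover have "k \<noteq> j2"
      using column_expansion_unique[OF rank, of \<alpha> \<beta> 0 1] col False by auto
    ultimately have neg: "(Hhat $ 1 $ l * Hhat $ 2 $ l) * (\<alpha> * \<beta>) < 0"
      if "Hhat $ 1 $ l * Hhat $ 2 $ l \<noteq> 0" for l
      using that False
      by (intro opposite_signs_of_minimal place_rows_column_minimal[OF min j _ _ col]) auto
    show ?thesis
    \<comment> \<open>The sign of \<open>\<alpha> * \<beta>\<close> is the same for all columns of
      \<open>Hhat\<close>, so it fixes one alternative for all of them; columns with zero product
      satisfy both.\<close>
    proof (cases "\<alpha> * \<beta> \<ge> 0")
      case True
      then have "Hhat $ 1 $ l * Hhat $ 2 $ l \<le> 0" for l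
        using neg[of l] True by (metis linorder_not_le mult_pos_pos less_eq_real_def mult_nonneg_nonneg)
      then show ?thesis
        using True by blast
    next
      case False
      then have "Hhat $ 1 $ l * Hhat $ 2 $ l \<ge> 0" for l
        using neg[of l] False by (metis linorder_not_le mult_neg_neg order_less_asym less_irrefl)
      then show ?thesis
        using False by auto
    qed
  qed blast
qed

end
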